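(* Let $G$ be a group with an abelian normal subgroup $A$ such that $G/C_G(A)$ is a Prüfer $p$-group for some prime $p$. Then the pseudocentre $P(G)$ is not trivial.
   Context: For a group $G$, the pseudocentre is $P(G)=\bigcap_{x\in G}C_G(x)^G$, where $C_G(x)$ is the centralizer of $x$ in $G$ and, for a subgroup $H\leq G$, $H^G$ is the normal closure of $H$ in $G$. A Prüfer $p$-group is a group isomorphic to $\mathbb Z_{p^\infty}=\mathbb Z[1/p]/\mathbb Z$. *)

theory Defs
  imports Complex_Main "HOL-Algebra.Coset" "HOL-Computational_Algebra.Primes"
begin

definition centralizer :: "('a, 'b) monoid_scheme \<Rightarrow> 'a set \<Rightarrow> 'a set" where
  "centralizer G S = {g \<in> carrier G. \<forall>s\<in>S. g \<otimes>\<^bsub>G\<^esub> s = s \<otimes>\<^bsub>G\<^esub> g}"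

definition normal_closure :: "('a, 'b) monoid_scheme \<Rightarrow> 'a set \<Rightarrow> 'a set" where
  "normal_closure G H = \<Inter> {N. N \<lhd> G \<and> H \<subseteq> N}"

definition pseudocentre :: "('a, 'b) monoid_scheme \<Rightarrow> 'a set" where
  "pseudocentre G = (\<Inter>x\<in>carrier G. normal_closure G (centralizer G {x}))"

(* The additive group of the ring Z[1/p], realised inside the rationals. *)
definition p_fractions_group :: "nat \<Rightarrow> rat monoid" where
  "p_fractions_group p =
     \<lparr>carrier = {of_int a / of_nat p ^ n | (a::int) (n::nat). True},
      monoid.mult = (+), one = 0\<rparr>"

definition prufer_group :: "nat \<Rightarrow> rat set monoid" where
  "prufer_group p = p_fractions_group p Mod \<int>"

end

theory Submission
  imports Defs
begin

text \<open>
  The nontrivial elements of a Pruefer group have a common nontrivial power, so there is a \<open>g\<close> outside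
  \<open>C = C\<^sub>G(A)\<close> such that for every \<open>x\<close> outside \<open>C\<close> some power of \<open>x\<close> acts on \<open>A\<close> as \<open>g\<close> does.
  Pick \<open>a\<close> in \<open>A\<close> not centralised by \<open>g\<close>. Then \<open>[g, a] \<noteq> 1\<close> lies in every \<open>C\<^sub>G(x)\<^sup>G\<close>: if \<open>x\<close> is in
  \<open>C\<close> because it lies in \<open>A\<close>, which centralises \<open>x\<close>, and otherwise because it equals
  \<open>[x\<^sup>k, a]\<close> for some \<open>k\<close>, where \<open>x\<close> is in \<open>C\<^sub>G(x)\<close>.
\<close>

text \<open>Once \<open>m_assoc\<close> has moved all brackets to the right, a factor next to its
  inverse inside a longer product appears in this shape, so the rule lets \<open>simp\<close> cancel
  it.\<close>

lemma (in group) inv_cancel_left: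
  assumes "x \<in> carrier G" "y \<in> carrier G"
  shows "x \<otimes> (inv x \<otimes> y) = y"
  using assms by (simp flip: m_assoc)

section \<open>Centralizers and elements of the pseudocentre\<close>

lemma (in group) centralizer_subgroup:
  assumes "S \<subseteq> carrier G"
  shows "subgroup (centralizer G S) G"
proof
  show "centralizer G S \<subseteq> carrier G" "\<one> \<in> centralizer G S"
    using assms by (auto simp: centralizer_def)
next
  fix x y assume x: "x \<in> centralizer G S" and y: "y \<in> centralizer G S"
  have "x \<otimes> y \<otimes> s = s \<otimes> (x \<otimes> y)" if "s \<in> S" for s
    using that x y assms unfolding centralizer_def
    by simp (metis m_assoc subsetD)
  then show "x \<otimes> y \<in> centralizer G S"
    using x y by (simp add: centralizer_def)
next
  fix x assume x: "x \<in> centralizer G S"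
  have "inv x \<otimes> s = s \<otimes> inv x" if "s \<in> S" for s
  proof -
    have xs: "x \<in> carrier G" "s \<in> carrier G" "x \<otimes> s = s \<otimes> x"
      using that x assms by (auto simp: centralizer_def)
    have "inv x \<otimes> s = inv x \<otimes> (s \<otimes> x) \<otimes> inv x"
      using xs(1,2) by (simp add: m_assoc)
    also have "\<dots> = s \<otimes> inv x"
      unfolding xs(3)[symmetric] using xs(1,2) by (simp flip: m_assoc)
    finally show ?thesis .
  qed
  then show "inv x \<in> centralizer G S"
    using x by (simp add: centralizer_def)
qed

text \<open>Conjugation by \<open>inv x\<close> maps \<open>A\<close> into itself, so
  \<open>h\<close> commutes with \<open>inv x \<otimes> a \<otimes> x\<close>; conjugating this
  relation back by \<open>x\<close> gives the claim for \<open>a\<close>.\<close>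

lemma (in group) centralizer_normal:
  assumes "A \<lhd> G"
  shows "centralizer G A \<lhd> G"
proof (rule normal_invI)
  interpret A: normal A G by fact
  show "subgroup (centralizer G A) G"
    by (rule centralizer_subgroup[OF A.subset])
  fix x h assume x: "x \<in> carrier G" and h: "h \<in> centralizer G A"
  have hG: "h \<in> carrier G" using h by (simp add: centralizer_def)
  have "x \<otimes> h \<otimes> inv x \<otimes> a = a \<otimes> (x \<otimes> h \<otimes> inv x)" if a: "a \<in> A" for a
  proof -
    have aG: "a \<in> carrier G" using a by (rule A.mem_carrier)
    have "inv x \<otimes> a \<otimes> x \<in> A" using A.inv_op_closed1[OF x a] .
    then have comm: "h \<otimes> (inv x \<otimes> a \<otimes> x) = inv x \<otimes> a \<otimes> x \<otimes> h"
      using h by (simp add: centralizer_def)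
    have "x \<otimes> h \<otimes> inv x \<otimes> a = x \<otimes> (h \<otimes> (inv x \<otimes> a \<otimes> x)) \<otimes> inv x"
      using x hG aG by (simp add: m_assoc)
    also have "\<dots> = a \<otimes> (x \<otimes> h \<otimes> inv x)"
      unfolding comm using x hG aG by (simp add: m_assoc inv_cancel_left)
    finally show ?thesis .
  qed
  then show "x \<otimes> h \<otimes> inv x \<in> centralizer G A"
    using x hG by (simp add: centralizer_def)
qed

text \<open>The group-theoretic half of the argument: the Pruefer group enters it only through the
  common power \<open>z\<close>.\<close>

lemma (in group) pseudocentre_nontrivial_if_common_power:
  assumes "A \<lhd> G"
    and z: "z \<in> carrier (G Mod centralizer G A)" "z \<noteq> centralizer G A"
    and power: "\<And>w. \<lbrakk>w \<in> carrier (G Mod centralizer G A); w \<noteq> centralizer G A\<rbrakk>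
      \<Longrightarrow> \<exists>k::nat. w [^]\<^bsub>G Mod centralizer G A\<^esub> k = z"
  shows "pseudocentre G \<noteq> {\<one>}"
proof -
  interpret A: normal A G by fact
  let ?C = "centralizer G A"
  interpret C: normal ?C G by (rule centralizer_normal[OF \<open>A \<lhd> G\<close>])
  obtain g where g: "g \<in> carrier G" and zg: "z = ?C #> g"
    using z(1) by (auto simp: carrier_FactGroup)
  have "g \<notin> ?C"
    using z(2) zg C.rcos_const[OF is_group] by auto
  then obtain a where a: "a \<in> A" and ga: "g \<otimes> a \<noteq> a \<otimes> g"
    using g unfolding centralizer_def by blast
  have aG: "a \<in> carrier G" using a by (rule A.mem_carrier)
  \<comment> \<open>The commutator of \<open>g\<close> and \<open>a\<close> is the element to be
    found in the pseudocentre.\<close>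
  define b where "b = g \<otimes> a \<otimes> inv g \<otimes> inv a"
  have "b \<noteq> \<one>"
  proof
    assume "b = \<one>"
    then have "g \<otimes> a \<otimes> inv g = inv (inv a)"
      using g aG unfolding b_def by (intro inv_equality[symmetric]) simp_all
    then have "a = g \<otimes> a \<otimes> inv g" using aG by simp
    then show False
      using ga g aG inv_solve_right[of a "g \<otimes> a" g] by simp
  qed
  have bA: "b \<in> A"
    unfolding b_def using A.inv_op_closed2[OF g a] a by simp
  \<comment> \<open>Pseudocentre and normal closure are both intersections, so membership is tested
    on each such \<open>N\<close> separately.\<close>
  have "b \<in> N" if x: "x \<in> carrier G" and N: "N \<lhd> G" "centralizer G {x} \<subseteq> N" for x N
  proof (cases "x \<in> ?C")
    case True
    then have "b \<in> centralizer G {x}"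
      using bA A.mem_carrier unfolding centralizer_def by simp
    then show ?thesis using N(2) by blast
  next
    case False
    interpret N: normal N G by fact
    have "?C #> x \<noteq> ?C"
      using False rcos_self[OF x C.is_subgroup] by auto
    then obtain k :: nat where "(?C #> x) [^]\<^bsub>G Mod ?C\<^esub> k = z"
      using power[of "?C #> x"] x by (auto simp: carrier_FactGroup)
    then have "?C #> (x [^] k) = ?C #> g"
      using C.FactGroup_pow[OF x] zg by simp
    then have "g \<in> ?C #> (x [^] k)"
      using rcos_self[OF g C.is_subgroup] by simp
    then obtain c where c: "c \<in> ?C" and gc: "g = c \<otimes> x [^] k"
      by (auto simp: r_coset_def)
    define y where "y = x [^] k"
    \<comment> \<open>\<open>x\<close> commutes with itself.\<close>
    have "x \<in> N" using N(2) x unfolding centralizer_def by blast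
    then have "y \<in> N"
      unfolding y_def by (induction k) auto
    have yG: "y \<in> carrier G" using x by (simp add: y_def)
    have cG: "c \<in> carrier G" using c by (rule C.mem_carrier)
    have "y \<otimes> a \<otimes> inv y \<in> A" by (rule A.inv_op_closed2[OF yG a])
    then have comm: "c \<otimes> (y \<otimes> a \<otimes> inv y) = y \<otimes> a \<otimes> inv y \<otimes> c"
      using c unfolding centralizer_def by blast
    \<comment> \<open>As \<open>c\<close> centralises \<open>A\<close>, it drops out and leaves the
      commutator of \<open>y\<close> and \<open>a\<close>. Bracketed as \<open>y\<close> times the
      conjugate of \<open>inv y\<close> by \<open>a\<close>, this is a product of elements of
      \<open>N\<close>.\<close>
    have "b = c \<otimes> (y \<otimes> a \<otimes> inv y) \<otimes> inv c \<otimes> inv a"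
      unfolding b_def gc y_def[symmetric] using yG cG aG
      by (simp add: m_assoc inv_mult_group)
    also have "\<dots> = y \<otimes> (a \<otimes> inv y \<otimes> inv a)"
      unfolding comm using yG cG aG by (simp add: m_assoc inv_cancel_left)
    also have "\<dots> \<in> N"
      using \<open>y \<in> N\<close> N.inv_op_closed2[OF aG] by simp
    finally show ?thesis .
  qed
  then have "b \<in> pseudocentre G"
    by (auto simp: pseudocentre_def normal_closure_def)
  with \<open>b \<noteq> \<one>\<close> show ?thesis by blast
qed

section \<open>The group Z[1/p] and its quotient by the integers\<close>

lemma rat_plus_p_fractions:
  assumes "p > 0"
  shows "(of_int a / of_nat p ^ m + of_int b / of_nat p ^ n :: rat)
    = of_int (a * int p ^ n + b * int p ^ m) / of_nat p ^ (m + n)"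
  using assms by (simp add: field_simps power_add)

lemma comm_group_p_fractions_group:
  assumes "p > 0"
  shows "comm_group (p_fractions_group p)"
proof (rule comm_groupI)
  let ?P = "p_fractions_group p"
  show "x \<otimes>\<^bsub>?P\<^esub> y \<in> carrier ?P" if xy: "x \<in> carrier ?P" "y \<in> carrier ?P" for x y
  proof -
    from xy obtain a m b n where "x = of_int a / of_nat p ^ m" "y = of_int b / of_nat p ^ n"
      by (auto simp: p_fractions_group_def)
    then have "x + y = of_int (a * int p ^ n + b * int p ^ m) / of_nat p ^ (m + n)"
      using rat_plus_p_fractions[OF assms] by simp
    then show ?thesis
      unfolding p_fractions_group_def monoid.simps partial_object.simps by blast
  qed
  have "(0 :: rat) = of_int 0 / of_nat p ^ 0" by simp
  then show "\<one>\<^bsub>?P\<^esub> \<in> carrier ?P"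
    unfolding p_fractions_group_def monoid.simps partial_object.simps by blast
  show "\<exists>y\<in>carrier ?P. y \<otimes>\<^bsub>?P\<^esub> x = \<one>\<^bsub>?P\<^esub>" if "x \<in> carrier ?P" for x
  proof -
    from that obtain a m where "x = of_int a / of_nat p ^ m"
      by (auto simp: p_fractions_group_def)
    then have "- x = of_int (- a) / of_nat p ^ m" by simp
    then have "- x \<in> carrier ?P"
      unfolding p_fractions_group_def monoid.simps partial_object.simps by blast
    then show ?thesis
      by (rule rev_bexI) (simp add: p_fractions_group_def)
  qed
qed (auto simp: p_fractions_group_def)

lemma Ints_subset_p_fractions: "\<int> \<subseteq> carrier (p_fractions_group p)"
proof
  fix x :: rat assume "x \<in> \<int>"
  then obtain a where "x = of_int a / of_nat p ^ 0"
    by (auto elim: Ints_cases)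
  then show "x \<in> carrier (p_fractions_group p)"
    unfolding p_fractions_group_def partial_object.simps by blast
qed

lemma normal_Ints_p_fractions_group:
  assumes "p > 0"
  shows "\<int> \<lhd> p_fractions_group p"
proof -
  interpret comm_group "p_fractions_group p"
    by (rule comm_group_p_fractions_group[OF assms])
  \<comment> \<open>Closure under the abstract group inverse reduces to closure under
    negation.\<close>
  have "inv\<^bsub>p_fractions_group p\<^esub> x = - x" if "x \<in> \<int>" for x
  proof (rule inv_equality)
    show "x \<in> carrier (p_fractions_group p)" "- x \<in> carrier (p_fractions_group p)"
      using that Ints_subset_p_fractions Ints_minus by blast+
  qed (simp add: p_fractions_group_def)
  then have "subgroup \<int> (p_fractions_group p)"
  proof (intro subgroupI)
    show "\<int> \<subseteq> carrier (p_fractions_group p)" by (rule Ints_subset_p_fractions)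
  qed (auto simp: p_fractions_group_def)
  then show ?thesis by (rule subgroup_imp_normal)
qed

lemma p_fractions_group_pow:
  fixes k :: nat
  shows "x [^]\<^bsub>p_fractions_group p\<^esub> k = of_nat k * x"
  by (induction k) (simp_all add: p_fractions_group_def nat_pow_def algebra_simps)

text \<open>The induction cancels factors \<open>p\<close> until \<open>a\<close> is prime to
  \<open>p\<close>; the exponent cannot reach 0, since the fraction is not an integer. Then an
  inverse of \<open>a\<close> modulo \<open>p\<close>, times a power of \<open>p\<close>, is the
  required multiplier.\<close>

lemma p_fraction_multiple_inverse:
  assumes "prime p" and "of_int a / of_nat p ^ n \<notin> (\<int> :: rat set)"
  shows "\<exists>k::nat. of_nat k * (of_int a / of_nat p ^ n) - 1 / of_nat p \<in> (\<int> :: rat set)"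
  using assms(2)
proof (induction n arbitrary: a)
  case 0
  then show ?case by simp
next
  case (Suc n)
  have p: "p > 0" using assms(1) by (rule prime_gt_0_nat)
  show ?case
  proof (cases "int p dvd a")
    case True
    then obtain b where "a = int p * b" ..
    then have eq: "(of_int a / of_nat p ^ Suc n :: rat) = of_int b / of_nat p ^ n"
      using p by simp
    show ?thesis using Suc unfolding eq by blast
  next
    case False
    then have "coprime a (int p)"
      using assms(1) by (metis coprime_commute prime_imp_coprime prime_nat_int_transfer)
    then obtain u v where uv: "u * a + v * int p = 1"
      using bezout_int[of a "int p"] by auto
    \<comment> \<open>The Bezout coefficient \<open>u\<close> may be negative, while the multiplier
      must be a natural number; its residue \<open>r\<close> still inverts \<open>a\<close> modulo
      \<open>p\<close>.\<close>
    define r q where "r = u mod int p" and "q = u div int p"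
    have "u = q * int p + r" unfolding r_def q_def by simp
    with uv have "r * a = 1 - (v + q * a) * int p" by (simp add: algebra_simps)
    then have ra: "(of_int r * of_int a :: rat) = 1 - of_int (v + q * a) * of_nat p"
      by (metis of_int_1 of_int_diff of_int_mult of_int_of_nat_eq)
    have r: "(of_nat (nat r) :: rat) = of_int r"
      using p by (simp add: r_def)
    \<comment> \<open>The factor \<open>p ^ n\<close> reduces the denominator to \<open>p\<close>,
      and \<open>r\<close> makes the numerator congruent to 1 modulo \<open>p\<close>.\<close>
    have "of_nat (nat r * p ^ n) * (of_int a / of_nat p ^ Suc n) - 1 / of_nat p
        = (of_int r * of_int a - 1) / (of_nat p :: rat)"
      using p r by (simp add: field_simps)
    also have "\<dots> = of_int (- (v + q * a))"
      unfolding ra using p by (simp add: field_simps)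
    finally show ?thesis by (metis Ints_of_int)
  qed
qed

text \<open>The class of \<open>1 / p\<close> works: it generates the subgroup of order
  \<open>p\<close>, which lies in every nontrivial subgroup.\<close>

lemma prufer_group_common_power:
  assumes "prime p"
  obtains z where "z \<in> carrier (prufer_group p)" "z \<noteq> \<one>\<^bsub>prufer_group p\<^esub>"
    and "\<And>w. \<lbrakk>w \<in> carrier (prufer_group p); w \<noteq> \<one>\<^bsub>prufer_group p\<^esub>\<rbrakk>
      \<Longrightarrow> \<exists>k::nat. w [^]\<^bsub>prufer_group p\<^esub> k = z"
proof
  let ?P = "p_fractions_group p"
  let ?z = "\<int> #>\<^bsub>?P\<^esub> (1 / of_nat p)"
  have p: "p > 1" using assms by (rule prime_gt_1_nat)
  interpret P: comm_group ?P using p by (intro comm_group_p_fractions_group) simp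
  interpret I: normal "\<int>" ?P using p by (intro normal_Ints_p_fractions_group) simp
  have zP: "1 / of_nat p \<in> carrier ?P"
    unfolding p_fractions_group_def by simp (metis of_int_1 power_one_right)
  then show "?z \<in> carrier (prufer_group p)"
    by (simp add: prufer_group_def carrier_FactGroup)
  \<comment> \<open>Otherwise \<open>p\<close> would be a unit of the integers.\<close>
  have "(1 / of_nat p :: rat) \<notin> \<int>"
  proof
    assume "(1 / of_nat p :: rat) \<in> \<int>"
    then obtain m where "(1 / of_nat p :: rat) = of_int m" by (auto elim: Ints_cases)
    then have "(of_int (m * int p) :: rat) = of_int 1" using p by (simp add: field_simps)
    then have "m * int p = 1" by (simp only: of_int_eq_iff)
    then show False using p by (simp add: zmult_eq_1_iff)
  qed
  then show "?z \<noteq> \<one>\<^bsub>prufer_group p\<^esub>"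
    using P.rcos_self[OF zP I.is_subgroup] by (auto simp: prufer_group_def)
  fix w assume "w \<in> carrier (prufer_group p)" and w1: "w \<noteq> \<one>\<^bsub>prufer_group p\<^esub>"
  then obtain x where x: "x \<in> carrier ?P" and w: "w = \<int> #>\<^bsub>?P\<^esub> x"
    by (auto simp: prufer_group_def carrier_FactGroup)
  have "x \<notin> \<int>"
    using w1 w I.rcos_const[OF P.is_group] by (auto simp: prufer_group_def)
  moreover obtain a n where "x = of_int a / of_nat p ^ n"
    using x by (auto simp: p_fractions_group_def)
  ultimately obtain k :: nat where k: "of_nat k * x - 1 / of_nat p \<in> \<int>"
    using p_fraction_multiple_inverse[OF assms] by blast
  have "of_nat k * x \<in> ?z"
    using k unfolding r_coset_def by (force simp: p_fractions_group_def)
  then have "\<int> #>\<^bsub>?P\<^esub> (of_nat k * x) = ?z"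
    using P.repr_independence[OF _ zP I.is_subgroup] by simp
  then show "\<exists>k::nat. w [^]\<^bsub>prufer_group p\<^esub> k = ?z"
    using I.FactGroup_pow[OF x] unfolding w prufer_group_def
    by (auto simp: p_fractions_group_pow)
qed

section \<open>Transport of the common power along the isomorphism\<close>

theorem theorem3p19:
  fixes G :: "('a, 'b) monoid_scheme" and A :: "'a set" and p :: nat
  assumes "group G"
    and "A \<lhd> G"
    and "comm_group (G\<lparr>carrier := A\<rparr>)"
    and "prime p"
    and "G Mod (centralizer G A) \<cong> prufer_group p"
  shows "pseudocentre G \<noteq> {\<one>\<^bsub>G\<^esub>}"
proof -
  interpret group G by fact
  let ?Q = "G Mod centralizer G A"
  interpret C: normal "centralizer G A" G by (rule centralizer_normal[OF assms(2)])
  have Q: "group ?Q" by (rule C.factorgroup_is_group)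
  have P: "group (prufer_group p)"
    unfolding prufer_group_def using \<open>prime p\<close>
    by (intro normal.factorgroup_is_group normal_Ints_p_fractions_group prime_gt_0_nat)
  \<comment> \<open>The isomorphism is inverted so that \<open>h\<close> pushes \<open>z\<close>
    forward to \<open>?Q\<close>; exponents carry over because \<open>h\<close> preserves
    powers.\<close>
  obtain h where h: "h \<in> iso (prufer_group p) ?Q"
    using group.iso_sym[OF Q assms(5)] by (auto simp: is_iso_def)
  then have hom: "h \<in> hom (prufer_group p) ?Q"
    and bij: "bij_betw h (carrier (prufer_group p)) (carrier ?Q)"
    by (auto simp: iso_def)
  interpret h: group_hom "prufer_group p" ?Q h
    using P Q hom by (simp add: group_hom_def group_hom_axioms_def)
  obtain z where z: "z \<in> carrier (prufer_group p)" "z \<noteq> \<one>\<^bsub>prufer_group p\<^esub>"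
    and power: "\<And>w. \<lbrakk>w \<in> carrier (prufer_group p); w \<noteq> \<one>\<^bsub>prufer_group p\<^esub>\<rbrakk>
      \<Longrightarrow> \<exists>k::nat. w [^]\<^bsub>prufer_group p\<^esub> k = z"
    using prufer_group_common_power[OF \<open>prime p\<close>] by blast
  show ?thesis
  proof (rule pseudocentre_nontrivial_if_common_power[OF assms(2)])
    show "h z \<in> carrier ?Q" using z(1) by simp
    \<comment> \<open>The identity of \<open>?Q\<close> is the coset \<open>centralizer G A\<close>
      itself, and injectivity of \<open>h\<close> keeps \<open>h z\<close> away from it.\<close>
    show "h z \<noteq> centralizer G A"
      using z bij h.hom_one by (metis bij_betw_inv_into_left h.G.one_closed one_FactGroup)
    fix w assume "w \<in> carrier ?Q" and w1: "w \<noteq> centralizer G A"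
    then obtain v where v: "v \<in> carrier (prufer_group p)" "w = h v"
      using bij by (auto simp: bij_betw_def)
    then have "v \<noteq> \<one>\<^bsub>prufer_group p\<^esub>"
      using w1 h.hom_one by auto
    then obtain k :: nat where "v [^]\<^bsub>prufer_group p\<^esub> k = z"
      using power v(1) by blast
    then have "w [^]\<^bsub>?Q\<^esub> k = h z"
      using h.hom_nat_pow[OF v(1)] v(2) by metis
    then show "\<exists>k::nat. w [^]\<^bsub>?Q\<^esub> k = h z" ..
  qed
qed

end
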